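(* Let $r$ and $w$ be integers with $r \ge w-1 \ge 1$ and $rw$ even, and let $v = r+w+1$. Then a generalized pentagonal geometry $\mathrm{PENT}(2,r,w)$ exists if and only if there exists a $w$-regular graph with $v$ vertices and girth at least $4$. Moreover, a generalized pentagonal geometry $\mathrm{PENT}(2,r,w)$ with pairwise disjoint opposite designs exists if and only if there exists a $w$-regular graph with $v$ vertices and girth at least $5$.
   Context: A Steiner system $S(2,k,w)$ is a pair $(W,\mathcal{B})$ where $W$ is a set of $w$ points and $\mathcal{B}$ is a set of $k$-subsets of $W$ (blocks) such that each pair of distinct points of $W$ lies in exactly one block. A generalized pentagonal geometry $\mathrm{PENT}(k,r,w)$ (with $k\ge 2$, $w\ge k$) is a (nonempty) partial linear space, i.e. a set of points together with a set of lines (sets of points) such that any two distinct points lie on at most one common line, in which every line contains exactly $k$ points, every point is on exactly $r$ lines, and for each point $x$ the set $W_x$ of points $y \ne x$ that are not collinear with $x$ (i.e. not on a common line with $x$) is the point set of a Steiner system $S(2,k,w)$ all of whose blocks are lines of the geometry. This Steiner system is called the opposite design to $x$ and denoted $x^{\mathrm{opp}}$. The geometry has pairwise disjoint opposite designs if for any two distinct points $x$ and $y$, $x^{\mathrm{opp}}$ and $y^{\mathrm{opp}}$ have no common block. Graphs are simple and undirected. *)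

theory Defs
  imports
    "HOL-Library.Ramsey"
    "HOL-Library.Extended_Nat"
    "HOL-Library.Infinite_Typeclass"
    "Graph_Theory.Graph_Theory"
begin

text \<open>Steiner systems \<open>S(2,k,w)\<close>; \<open>[W]\<^bsup>k\<^esup>\<close> is the set of \<open>k\<close>-subsets of \<open>W\<close>.\<close>

definition steiner_system :: "'a set \<Rightarrow> 'a set set \<Rightarrow> nat \<Rightarrow> nat \<Rightarrow> bool" where
  "steiner_system W B k w \<longleftrightarrow>
     finite W \<and> card W = w \<and> B \<subseteq> [W]\<^bsup>k\<^esup> \<and>
     (\<forall>x\<in>W. \<forall>y\<in>W. x \<noteq> y \<longrightarrow> (\<exists>!b. b \<in> B \<and> x \<in> b \<and> y \<in> b))"

definition partial_linear_space :: "'a set \<Rightarrow> 'a set set \<Rightarrow> bool" where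
  "partial_linear_space P L \<longleftrightarrow>
     (\<forall>l\<in>L. l \<subseteq> P) \<and>
     (\<forall>x\<in>P. \<forall>y\<in>P. x \<noteq> y \<longrightarrow>
        (\<forall>l\<in>L. \<forall>m\<in>L. x \<in> l \<and> y \<in> l \<and> x \<in> m \<and> y \<in> m \<longrightarrow> l = m))"

definition collinear_in :: "'a set set \<Rightarrow> 'a \<Rightarrow> 'a \<Rightarrow> bool" where
  "collinear_in L x y \<longleftrightarrow> (\<exists>l\<in>L. x \<in> l \<and> y \<in> l)"

definition noncollinear_points :: "'a set \<Rightarrow> 'a set set \<Rightarrow> 'a \<Rightarrow> 'a set" where
  "noncollinear_points P L x = {y \<in> P. y \<noteq> x \<and> \<not> collinear_in L x y}"

text \<open>\<open>opposite_design P L k w x B\<close> says that \<open>B\<close> is the block set of \<open>x\<^sup>o\<^sup>p\<^sup>p\<close>. For \<open>k \<ge> 2\<close>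
  there is at most one such \<open>B\<close>, see \<open>opposite_design_unique\<close> below.\<close>

definition opposite_design ::
    "'a set \<Rightarrow> 'a set set \<Rightarrow> nat \<Rightarrow> nat \<Rightarrow> 'a \<Rightarrow> 'a set set \<Rightarrow> bool" where
  "opposite_design P L k w x B \<longleftrightarrow>
     steiner_system (noncollinear_points P L x) B k w \<and> B \<subseteq> L"

definition pent :: "'a set \<Rightarrow> 'a set set \<Rightarrow> nat \<Rightarrow> nat \<Rightarrow> nat \<Rightarrow> bool" where
  "pent P L k r w \<longleftrightarrow>
     k \<ge> 2 \<and> w \<ge> k \<and> P \<noteq> {} \<and> partial_linear_space P L \<and>
     (\<forall>l\<in>L. finite l \<and> card l = k) \<and>
     (\<forall>x\<in>P. finite {l \<in> L. x \<in> l} \<and> card {l \<in> L. x \<in> l} = r) \<and>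
     (\<forall>x\<in>P. \<exists>B. opposite_design P L k w x B)"

definition disjoint_opposite_designs :: "'a set \<Rightarrow> 'a set set \<Rightarrow> nat \<Rightarrow> nat \<Rightarrow> bool" where
  "disjoint_opposite_designs P L k w \<longleftrightarrow>
     (\<forall>x\<in>P. \<forall>y\<in>P. x \<noteq> y \<longrightarrow>
        (\<forall>B C. opposite_design P L k w x B \<and> opposite_design P L k w y C \<longrightarrow> B \<inter> C = {}))"

lemma opposite_design_unique:
  assumes pls: "partial_linear_space P L" and k: "k \<ge> 2"
    and B: "opposite_design P L k w x B" and C: "opposite_design P L k w x C"
  shows "B = C"
proof -
  have "B \<subseteq> C" if B: "opposite_design P L k w x B" and C: "opposite_design P L k w x C" for B C
  proof
    fix b assume b: "b \<in> B"
    let ?W = "noncollinear_points P L x"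
    have bW: "b \<subseteq> ?W" "card b = k" "b \<in> L" and BC: "C \<subseteq> L"
      using B C b by (auto simp: opposite_design_def steiner_system_def nsets_def)
    from bW(2) k have "Suc (Suc 0) \<le> card b" by simp
    then obtain y z where yz: "y \<in> b" "z \<in> b" "y \<noteq> z"
      by (metis card_le_Suc0_iff_eq card.infinite not_less_eq_eq zero_le)
    have "y \<in> ?W" "z \<in> ?W" using yz bW by auto
    then obtain c where c: "c \<in> C" "y \<in> c" "z \<in> c"
      using C yz(3) unfolding opposite_design_def steiner_system_def by blast
    have "y \<in> P" "z \<in> P" using \<open>y \<in> ?W\<close> \<open>z \<in> ?W\<close> by (auto simp: noncollinear_points_def)
    then have "b = c"
      using pls yz c bW BC unfolding partial_linear_space_def by blast
    with c show "b \<in> C" by simp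
  qed
  with B C show ?thesis by blast
qed

text \<open>
  Finite simple undirected graphs are \<open>pair_graph\<close>s: every edge \<open>uv\<close> is represented by the two
  arcs \<open>(u,v)\<close> and \<open>(v,u)\<close>, so the degree of a vertex is its \<open>out_degree\<close>.
\<close>

definition regular_graph :: "'a pair_pre_digraph \<Rightarrow> nat \<Rightarrow> bool" where
  "regular_graph G d \<longleftrightarrow>
     pair_graph G \<and> (\<forall>u\<in>pverts G. out_degree (with_proj G) u = d)"

text \<open>
  The library predicate \<open>cycle\<close> also admits the closed walks \<open>u, v, u\<close> along a single edge, which are
  not cycles of the undirected graph; hence the condition on the length. The infimum
  is \<open>\<infinity>\<close> for acyclic graphs.
\<close>

definition girth :: "'a pair_pre_digraph \<Rightarrow> enat" where
  "girth G = (INF p \<in> {p. pre_digraph.cycle (with_proj G) p \<and> 3 \<le> length p}. enat (length p))"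

text \<open>
  Existence is stated over arbitrary types of class \<open>infinite\<close>. All geometries and graphs
  involved are finite, so each has an isomorphic copy on any such type.
\<close>

end

theory Submission
  imports Defs
begin

text \<open>
  For \<open>k = 2\<close> the lines of a partial linear space on \<open>P\<close> are just the edges of a graph on \<open>P\<close>, and
  noncollinearity is adjacency in the complementary graph \<open>G\<close>. So the opposite design of \<open>x\<close> lives
  on the neighbourhood \<open>N(x)\<close> of \<open>x\<close> in \<open>G\<close>. An \<open>S(2,2,w)\<close> is the complete graph on \<open>w\<close> points
  (lemma \<open>steiner_system_2_iff\<close>), hence \<open>x\<^sup>o\<^sup>p\<^sup>p\<close> exists iff \<open>N(x)\<close> has \<open>w\<close> elements and no
  two of them are adjacent in \<open>G\<close>. Over all \<open>x\<close> this says that \<open>G\<close> is \<open>w\<close>-regular and has no triangle.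
  The \<open>r\<close> lines through \<open>x\<close> account for the remaining points, so \<open>card P = r + w + 1\<close>
  (lemma \<open>pent_complement_lines_iff\<close>).

  A common block of \<open>x\<^sup>o\<^sup>p\<^sup>p\<close> and \<open>y\<^sup>o\<^sup>p\<^sup>p\<close> is a pair of common neighbours of \<open>x\<close> and \<open>y\<close> in \<open>G\<close>,
  that is, a 4-cycle through \<open>x\<close> and \<open>y\<close> as opposite corners (lemma
  \<open>disjoint_opposite_designs_complement_lines_iff\<close>). Girth at least 4 means that there are no triangles,
  and girth at least 5 that there are no 4-cycles either.

  Points and vertices are drawn from different infinite types. Since everything is finite, a graph
  can be copied from one type to the other (lemma \<open>regular_graph_copy\<close>).
\<close>

section \<open>Girth and short cycles\<close>

lemma le_girth_iff:
  "enat n \<le> girth G \<longleftrightarrow>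
     (\<forall>p. pre_digraph.cycle (with_proj G) p \<and> 3 \<le> length p \<longrightarrow> n \<le> length p)"
  by (auto simp: girth_def le_INF_iff)

context pair_wf_digraph
begin

lemma ex_cycle_length_3_iff:
  "(\<exists>p. cycle p \<and> length p = 3) \<longleftrightarrow>
     (\<exists>u v x. (u, v) \<in> parcs G \<and> (v, x) \<in> parcs G \<and> (x, u) \<in> parcs G \<and> distinct [u, v, x])"
  (is "?L \<longleftrightarrow> ?R")
proof
  assume ?L
  then show ?R
    by (fastforce simp: cycle_def awalk_simps numeral_3_eq_3 length_Suc_conv)
next
  assume ?R
  then obtain u v x where "(u, v) \<in> parcs G" "(v, x) \<in> parcs G" "(x, u) \<in> parcs G"
    and "distinct [u, v, x]" by blast
  then have "cycle [(u, v), (v, x), (x, u)]"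
    by (auto simp: cycle_def awalk_simps dest: wellformed')
  then show ?L by force
qed

lemma ex_cycle_length_4_iff:
  "(\<exists>p. cycle p \<and> length p = 4) \<longleftrightarrow>
     (\<exists>u v x y. (u, v) \<in> parcs G \<and> (v, x) \<in> parcs G \<and> (x, y) \<in> parcs G \<and> (y, u) \<in> parcs G \<and>
        distinct [u, v, x, y])"
  (is "?L \<longleftrightarrow> ?R")
proof
  assume ?L
  then obtain p u where "awalk u p u" "distinct (tl (awalk_verts u p))" "length p = 4"
    by (auto simp: cycle_def)
  moreover from \<open>length p = 4\<close> obtain a b c d where "p = [a, b, c, d]"
    by (auto simp: eval_nat_numeral length_Suc_conv)
  ultimately have "(fst a, fst b) \<in> parcs G" "(fst b, fst c) \<in> parcs G"
    "(fst c, fst d) \<in> parcs G" "(fst d, fst a) \<in> parcs G" "distinct [fst a, fst b, fst c, fst d]"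
    by (cases a; cases b; cases c; cases d; auto simp: awalk_simps)+
  then show ?R by blast
next
  assume ?R
  then obtain u v x y where "(u, v) \<in> parcs G" "(v, x) \<in> parcs G" "(x, y) \<in> parcs G"
    "(y, u) \<in> parcs G" and "distinct [u, v, x, y]" by blast
  then have "cycle [(u, v), (v, x), (x, y), (y, u)]"
    by (auto simp: cycle_def awalk_simps dest: wellformed')
  then show ?L by force
qed

end

text \<open>Both conditions are phrased by neighbourhoods, because that is where the opposite designs live;
  for graphs they exclude cycles of length 3 and 4, as shown below.\<close>

definition triangle_free :: "'a rel \<Rightarrow> bool" where
  "triangle_free E \<longleftrightarrow> (\<forall>x y z. (x, y) \<in> E \<and> (x, z) \<in> E \<longrightarrow> (y, z) \<notin> E)"

definition common_neighbours_unique :: "'a rel \<Rightarrow> bool" where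
  "common_neighbours_unique E \<longleftrightarrow>
     (\<forall>x y u v. x \<noteq> y \<and> (x, u) \<in> E \<and> (x, v) \<in> E \<and> (y, u) \<in> E \<and> (y, v) \<in> E \<longrightarrow> u = v)"

context pair_graph
begin

lemma triangle_free_iff_no_cycle_3:
  "triangle_free (parcs G) \<longleftrightarrow> \<not> (\<exists>p. cycle p \<and> length p = 3)"
  unfolding ex_cycle_length_3_iff triangle_free_def
  using arcs_symmetric no_loops' by (simp; metis)

text \<open>In a 4-cycle \<open>u, v, x, y\<close> the opposite corners \<open>u\<close> and \<open>x\<close> have the two common neighbours
  \<open>v\<close> and \<open>y\<close>. Conversely, two common neighbours of two vertices close up to a 4-cycle, whose
  corners are distinct because there are no loops.\<close>

lemma common_neighbours_unique_iff_no_cycle_4: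
  "common_neighbours_unique (parcs G) \<longleftrightarrow> \<not> (\<exists>p. cycle p \<and> length p = 4)"
  unfolding ex_cycle_length_4_iff common_neighbours_unique_def
  using arcs_symmetric no_loops' by (simp; metis)

lemma girth_ge_4_iff: "girth G \<ge> 4 \<longleftrightarrow> triangle_free (parcs G)"
proof -
  have "girth G \<ge> 4 \<longleftrightarrow> (\<forall>p. cycle p \<and> 3 \<le> length p \<longrightarrow> 4 \<le> length p)"
    using le_girth_iff[of 4 G] by (simp add: numeral_eq_enat)
  also have "\<dots> \<longleftrightarrow> \<not> (\<exists>p. cycle p \<and> length p = 3)"
    by (force simp: le_eq_less_or_eq)
  finally show ?thesis by (simp add: triangle_free_iff_no_cycle_3)
qed

lemma girth_ge_5_iff:
  "girth G \<ge> 5 \<longleftrightarrow> triangle_free (parcs G) \<and> common_neighbours_unique (parcs G)"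
proof -
  have "girth G \<ge> 5 \<longleftrightarrow> (\<forall>p. cycle p \<and> 3 \<le> length p \<longrightarrow> 5 \<le> length p)"
    using le_girth_iff[of 5 G] by (simp add: numeral_eq_enat)
  also have "\<dots> \<longleftrightarrow> (\<forall>p. cycle p \<longrightarrow> length p \<noteq> 3 \<and> length p \<noteq> 4)"
  proof -
    have "(3 \<le> n \<longrightarrow> 5 \<le> n) \<longleftrightarrow> n \<noteq> 3 \<and> n \<noteq> 4" for n :: nat by auto
    then show ?thesis by blast
  qed
  finally show ?thesis
    by (auto simp: triangle_free_iff_no_cycle_3 common_neighbours_unique_iff_no_cycle_4)
qed

end

section \<open>Copying a graph along an injection\<close>

definition map_pair_graph :: "('a \<Rightarrow> 'b) \<Rightarrow> 'a pair_pre_digraph \<Rightarrow> 'b pair_pre_digraph" where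
  "map_pair_graph f G = \<lparr>pverts = f ` pverts G, parcs = map_prod f f ` parcs G\<rparr>"

definition pair_hom :: "('a \<Rightarrow> 'b) \<Rightarrow> ('a, 'a \<times> 'a, 'b, 'b \<times> 'b) digraph_isomorphism" where
  "pair_hom f = \<lparr>iso_verts = f, iso_arcs = map_prod f f, iso_head = snd, iso_tail = fst\<rparr>"

lemma with_proj_map_pair_graph:
  "with_proj (map_pair_graph f G) = app_iso (pair_hom f) (with_proj G)"
  by (simp add: with_proj_def map_pair_graph_def app_iso_def pair_hom_def)

lemma (in pair_wf_digraph) digraph_isomorphism_pair_hom:
  assumes "inj_on f (pverts G)"
  shows "digraph_isomorphism (pair_hom f)"
proof -
  have "inj_on (map_prod f f) (parcs G)"
    by (rule inj_on_subset[OF map_prod_inj_on[OF assms assms]]) (auto dest: wellformed')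
  then show ?thesis
    using assms wf_digraph_axioms by (auto simp: digraph_isomorphism_def pair_hom_def)
qed

lemma (in pair_graph) pair_graph_map:
  assumes "inj_on f (pverts G)"
  shows "pair_graph (map_pair_graph f G)"
proof unfold_locales
  show "symmetric (with_proj (map_pair_graph f G))"
    using arcs_symmetric by (force simp: symmetric_def map_pair_graph_def intro!: symI)
next
  fix e assume "e \<in> parcs (map_pair_graph f G)"
  then show "fst e \<noteq> snd e"
    using assms no_loops' wellformed' by (fastforce simp: map_pair_graph_def dest: inj_onD)
qed (auto simp: map_pair_graph_def dest: wellformed')

lemma regular_graph_map:
  assumes G: "regular_graph G d" and f: "inj_on f (pverts G)"
  shows "regular_graph (map_pair_graph f G) d"
proof -
  interpret pair_graph G using G by (simp add: regular_graph_def)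
  note hom = digraph_isomorphism_pair_hom[OF f]
  have "out_degree (with_proj (map_pair_graph f G)) (f u) = d" if "u \<in> pverts G" for u
    using out_degree_app_iso_eq[OF hom that] G that
    by (simp add: with_proj_map_pair_graph regular_graph_def pair_hom_def)
  then show ?thesis
    using pair_graph_map[OF f] by (auto simp: regular_graph_def map_pair_graph_def)
qed

text \<open>Pulling a cycle of the copy back along the inverse isomorphism gives a cycle of \<open>G\<close> of
  the same length.\<close>

lemma (in pair_wf_digraph) girth_map_ge:
  assumes f: "inj_on f (pverts G)"
  shows "girth G \<le> girth (map_pair_graph f G)"
proof -
  let ?h = "pair_hom f"
  let ?H = "app_iso ?h (with_proj G)"
  note hom = digraph_isomorphism_pair_hom[OF f]
  have "\<exists>q. cycle q \<and> length q = length p" if "pre_digraph.cycle ?H p" for p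
  proof -
    obtain u where u: "pre_digraph.awalk ?H u p u" "p \<noteq> []"
      "distinct (tl (pre_digraph.awalk_verts ?H u p))"
      using \<open>pre_digraph.cycle ?H p\<close> by (auto simp: pre_digraph.cycle_def)
    let ?q = "map (iso_arcs (inv_iso ?h)) p" and ?u = "iso_verts (inv_iso ?h) u"
    have q: "awalk ?u ?q ?u"
      using awalk_app_isoD[OF u(1) hom] .
    have "iso_verts ?h ?u = u" "map (iso_arcs ?h) ?q = p"
      using u(1) iso_verts_iso_inv[OF hom] iso_arcs_iso_inv[OF hom]
      by (auto simp: pre_digraph.awalk_def subset_iff intro!: map_idI)
    then have "pre_digraph.awalk_verts ?H u p = map (iso_verts ?h) (awalk_verts ?u ?q)"
      using awalk_verts_app_iso_eq[OF hom q] by simp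
    then have "distinct (tl (awalk_verts ?u ?q))"
      using u(3) by (simp add: map_tl[symmetric] distinct_map)
    with q have "cycle ?q"
      using \<open>p \<noteq> []\<close> by (auto simp: cycle_def)
    then show ?thesis by force
  qed
  then show ?thesis
    unfolding girth_def with_proj_map_pair_graph by (intro INF_mono) fastforce
qed

lemma regular_graph_copy:
  assumes "regular_graph (G :: 'a pair_pre_digraph) d \<and> card (pverts G) = n \<and> g \<le> girth G"
  shows "\<exists>H :: 'b::infinite pair_pre_digraph.
    regular_graph H d \<and> card (pverts H) = n \<and> g \<le> girth H"
proof -
  interpret pair_graph G using assms by (simp add: regular_graph_def)
  obtain B :: "'b set" where "finite B" "card B = card (pverts G)"
    using infinite_arbitrarily_large[OF infinite_UNIV] by blast
  then obtain f where "bij_betw f (pverts G) B"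
    using pair_finite_verts finite_same_card_bij by metis
  then have f: "inj_on f (pverts G)" by (simp add: bij_betw_def)
  have "regular_graph (map_pair_graph f G) d"
    using assms f by (simp add: regular_graph_map)
  moreover have "card (pverts (map_pair_graph f G)) = n"
    using assms card_image[OF f] by (simp add: map_pair_graph_def)
  moreover have "g \<le> girth (map_pair_graph f G)"
    using assms girth_map_ge[OF f] by (meson order_trans)
  ultimately show ?thesis by blast
qed

section \<open>Graphs and geometries with lines of size two\<close>

text \<open>The following two constructions translate between graphs on \<open>P\<close> and sets of two-point lines on
  \<open>P\<close>; the arcs of the graph are the noncollinear pairs, not the lines.\<close>

definition complement_lines :: "'a pair_pre_digraph \<Rightarrow> 'a set set" where
  "complement_lines G = {{x, y} | x y. x \<in> pverts G \<and> y \<in> pverts G \<and> x \<noteq> y \<and> (x, y) \<notin> parcs G}"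

definition noncollinearity_graph :: "'a set \<Rightarrow> 'a set set \<Rightarrow> 'a pair_pre_digraph" where
  "noncollinearity_graph P L =
     \<lparr>pverts = P, parcs = {(x, y). x \<in> P \<and> y \<in> noncollinear_points P L x}\<rparr>"

text \<open>Every pair of points must be covered, and the only 2-set that covers it is the pair itself.\<close>

lemma steiner_system_2_iff:
  "steiner_system W B 2 w \<longleftrightarrow> finite W \<and> card W = w \<and> B = [W]\<^bsup>2\<^esup>"
proof
  assume *: "steiner_system W B 2 w"
  have "b \<in> B" if "b \<in> [W]\<^bsup>2\<^esup>" for b
  proof -
    obtain x y where b: "b = {x, y}" "x \<noteq> y" "x \<in> W" "y \<in> W"
      using \<open>b \<in> [W]\<^bsup>2\<^esup>\<close> by (auto simp: nsets_def card_2_iff)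
    then obtain c where "c \<in> B" "x \<in> c" "y \<in> c"
      using * unfolding steiner_system_def by blast
    moreover have "card c = 2"
      using * \<open>c \<in> B\<close> by (auto simp: steiner_system_def nsets_def)
    ultimately show "b \<in> B"
      using b by (auto simp: card_2_iff doubleton_eq_iff insert_commute)
  qed
  then show "finite W \<and> card W = w \<and> B = [W]\<^bsup>2\<^esup>"
    using * by (auto simp: steiner_system_def)
next
  assume *: "finite W \<and> card W = w \<and> B = [W]\<^bsup>2\<^esup>"
  have "\<exists>!b. b \<in> [W]\<^bsup>2\<^esup> \<and> x \<in> b \<and> y \<in> b" if "x \<in> W" "y \<in> W" "x \<noteq> y" for x y
    by (rule ex1I[of _ "{x, y}"]) (use that in \<open>auto simp: nsets_def card_2_iff\<close>)
  then show "steiner_system W B 2 w"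
    using * by (simp add: steiner_system_def)
qed

lemma collinear_in_iff_doubleton:
  assumes "\<And>l. l \<in> L \<Longrightarrow> card l = 2" and "x \<noteq> y"
  shows "collinear_in L x y \<longleftrightarrow> {x, y} \<in> L"
proof
  assume "collinear_in L x y"
  then obtain l where l: "l \<in> L" "x \<in> l" "y \<in> l"
    by (auto simp: collinear_in_def)
  then have "card l = 2" using assms by blast
  then have "{x, y} = l"
    using l \<open>x \<noteq> y\<close> by (intro card_subset_eq) (auto intro: card_ge_0_finite)
  with l show "{x, y} \<in> L" by simp
qed (auto simp: collinear_in_def)

lemma complement_lines_noncollinearity_graph:
  assumes "\<And>l. l \<in> L \<Longrightarrow> l \<subseteq> P \<and> card l = 2"
  shows "complement_lines (noncollinearity_graph P L) = L"
proof -
  have collinear: "collinear_in L x y \<longleftrightarrow> {x, y} \<in> L" if "x \<noteq> y" for x y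
    using that by (rule collinear_in_iff_doubleton[rotated]) (simp add: assms)
  have "l \<in> complement_lines (noncollinearity_graph P L) \<longleftrightarrow> l \<in> L" for l
  proof
    assume "l \<in> L"
    moreover from this obtain x y where l: "l = {x, y}" "x \<noteq> y"
      using assms by (meson card_2_iff)
    ultimately have "x \<in> P" "y \<in> P" "collinear_in L x y"
      using assms[of l] collinear[of x y] by simp_all
    with l show "l \<in> complement_lines (noncollinearity_graph P L)"
      by (auto simp: complement_lines_def noncollinearity_graph_def noncollinear_points_def)
  qed (auto simp: complement_lines_def noncollinearity_graph_def noncollinear_points_def collinear)
  then show ?thesis by blast
qed

text \<open>Starting from any point, the finitely many finite lines through it and the finite
  opposite design reach every point.\<close>

lemma finite_points_of_pent:
  assumes "pent P L k r w"
  shows "finite P"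
proof -
  obtain x where x: "x \<in> P" using assms by (auto simp: pent_def)
  have "finite (noncollinear_points P L x)"
    using assms x by (auto simp: pent_def opposite_design_def steiner_system_def)
  moreover have "finite (\<Union>{l \<in> L. x \<in> l})"
    using assms x by (auto simp: pent_def)
  moreover have "P \<subseteq> {x} \<union> noncollinear_points P L x \<union> \<Union>{l \<in> L. x \<in> l}"
    by (auto simp: noncollinear_points_def collinear_in_def)
  ultimately show ?thesis by (simp add: finite_subset)
qed

lemma pair_graph_noncollinearity_graph:
  assumes "finite P"
  shows "pair_graph (noncollinearity_graph P L)"
proof unfold_locales
  have "parcs (noncollinearity_graph P L) \<subseteq> P \<times> P"
    by (auto simp: noncollinearity_graph_def noncollinear_points_def)
  then show "finite (parcs (noncollinearity_graph P L))"
    using assms by (simp add: finite_subset)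
  show "symmetric (with_proj (noncollinearity_graph P L))"
    by (auto simp: symmetric_def noncollinearity_graph_def noncollinear_points_def collinear_in_def
        intro!: symI)
qed (use assms in \<open>auto simp: noncollinearity_graph_def noncollinear_points_def\<close>)

text \<open>Hence no geometry with lines of size two is lost by considering only complements of graphs.\<close>

lemma pent_2_obtains_graph:
  assumes "pent P L 2 r w"
  obtains G where "pair_graph G" "pverts G = P" "complement_lines G = L"
proof
  show "pair_graph (noncollinearity_graph P L)"
    using assms by (intro pair_graph_noncollinearity_graph finite_points_of_pent)
  show "pverts (noncollinearity_graph P L) = P"
    by (simp add: noncollinearity_graph_def)
  show "complement_lines (noncollinearity_graph P L) = L"
    using assms
    by (intro complement_lines_noncollinearity_graph) (auto simp: pent_def partial_linear_space_def)
qed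

context pair_graph
begin

lemma doubleton_in_complement_lines_iff:
  "{x, y} \<in> complement_lines G \<longleftrightarrow> x \<in> pverts G \<and> y \<in> pverts G \<and> x \<noteq> y \<and> (x, y) \<notin> parcs G"
proof
  assume "{x, y} \<in> complement_lines G"
  then obtain a b where "{x, y} = {a, b}" "a \<in> pverts G" "b \<in> pverts G" "a \<noteq> b" "(a, b) \<notin> parcs G"
    by (auto simp: complement_lines_def)
  then show "x \<in> pverts G \<and> y \<in> pverts G \<and> x \<noteq> y \<and> (x, y) \<notin> parcs G"
    using arcs_symmetric[of x y] by (metis doubleton_eq_iff)
qed (auto simp: complement_lines_def)

lemma noncollinear_points_complement_lines:
  assumes "x \<in> pverts G"
  shows "noncollinear_points (pverts G) (complement_lines G) x = parcs G `` {x}"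
proof -
  have "collinear_in (complement_lines G) x y \<longleftrightarrow> {x, y} \<in> complement_lines G" if "x \<noteq> y" for y
    using that by (intro collinear_in_iff_doubleton) (auto simp: complement_lines_def)
  then show ?thesis
    using assms
    by (auto simp: noncollinear_points_def doubleton_in_complement_lines_iff
        dest: wellformed' no_loops')
qed

lemma finite_neighbours: "finite (parcs G `` {x})"
  using pair_finite_arcs by (rule finite_Image)

lemma out_degree_eq_card_neighbours: "out_degree (with_proj G) x = card (parcs G `` {x})"
proof -
  have "out_arcs (with_proj G) x = Pair x ` (parcs G `` {x})"
    by (auto simp: out_arcs_def)
  then show ?thesis
    by (simp add: out_degree_def card_image inj_on_def)
qed

text \<open>The blocks can only be all pairs of neighbours of \<open>x\<close>, and these pairs are lines exactly if
  no two neighbours are adjacent.\<close>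

lemma opposite_design_complement_lines_iff:
  assumes "x \<in> pverts G"
  shows "opposite_design (pverts G) (complement_lines G) 2 w x B \<longleftrightarrow>
    card (parcs G `` {x}) = w \<and> B = [parcs G `` {x}]\<^bsup>2\<^esup> \<and>
    (\<forall>y z. (x, y) \<in> parcs G \<and> (x, z) \<in> parcs G \<longrightarrow> (y, z) \<notin> parcs G)"
proof -
  have "[parcs G `` {x}]\<^bsup>2\<^esup> \<subseteq> complement_lines G \<longleftrightarrow>
    (\<forall>y z. (x, y) \<in> parcs G \<and> (x, z) \<in> parcs G \<longrightarrow> (y, z) \<notin> parcs G)" (is "?L \<longleftrightarrow> ?R")
  proof
    assume L: ?L
    show ?R
    proof (intro allI impI notI, elim conjE)
      fix y z assume *: "(x, y) \<in> parcs G" "(x, z) \<in> parcs G" "(y, z) \<in> parcs G"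
      then have "{y, z} \<in> [parcs G `` {x}]\<^bsup>2\<^esup>"
        using no_loops'[OF *(3)] by (simp add: nsets_def)
      then have "{y, z} \<in> complement_lines G" using L by blast
      with * show False by (simp add: doubleton_in_complement_lines_iff)
    qed
  next
    assume R: ?R
    show ?L
    proof
      fix b assume "b \<in> [parcs G `` {x}]\<^bsup>2\<^esup>"
      then obtain y z where b: "b = {y, z}" "y \<noteq> z" "(x, y) \<in> parcs G" "(x, z) \<in> parcs G"
        by (auto simp: nsets_def card_2_iff)
      moreover from b R have "(y, z) \<notin> parcs G" by blast
      ultimately show "b \<in> complement_lines G"
        by (auto simp: doubleton_in_complement_lines_iff dest: wellformed')
    qed
  qed
  then show ?thesis
    using assms finite_neighbours
    by (auto simp: opposite_design_def noncollinear_points_complement_lines steiner_system_2_iff)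
qed

lemma partial_linear_space_complement_lines:
  "partial_linear_space (pverts G) (complement_lines G)"
  by (auto simp: partial_linear_space_def complement_lines_def)

text \<open>Besides \<open>x\<close> and its neighbours there is one point for each line through \<open>x\<close>.\<close>

lemma card_pverts_eq_lines_plus_neighbours:
  assumes x: "x \<in> pverts G"
  shows "card (pverts G) = card {l \<in> complement_lines G. x \<in> l} + card (parcs G `` {x}) + 1"
proof -
  let ?N = "parcs G `` {x}" and ?C = "pverts G - insert x (parcs G `` {x})"
  have "{l \<in> complement_lines G. x \<in> l} = (\<lambda>y. {x, y}) ` ?C"
    using x by (auto simp: complement_lines_def insert_commute dest: arcs_symmetric)
  moreover have "inj_on (\<lambda>y. {x, y}) ?C"
    by (auto simp: inj_on_def doubleton_eq_iff)
  ultimately have "card {l \<in> complement_lines G. x \<in> l} = card ?C"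
    by (simp add: card_image)
  moreover have "card (pverts G) = card ?C + card (insert x ?N)"
  proof -
    have "insert x ?N \<subseteq> pverts G" using x by (auto dest: wellformed')
    then show ?thesis
      using card_Diff_subset[of "insert x ?N" "pverts G"] card_mono[of "pverts G" "insert x ?N"]
        pair_finite_verts finite_subset[of "insert x ?N" "pverts G"] by simp
  qed
  moreover have "x \<notin> ?N" using no_loops' by auto
  ultimately show ?thesis by (simp add: finite_neighbours)
qed

text \<open>Existence of all opposite designs gives regularity and triangle-freeness, and conversely. Once
  the degree is known to be \<open>w\<close>, having \<open>r\<close> lines through a point is the same as having
  \<open>r + w + 1\<close> points in total.\<close>

lemma pent_complement_lines_iff:
  assumes "w \<ge> 2"
  shows "pent (pverts G) (complement_lines G) 2 r w \<longleftrightarrow>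
    regular_graph G w \<and> card (pverts G) = r + w + 1 \<and> girth G \<ge> 4"
proof -
  have lines: "finite l \<and> card l = 2" if "l \<in> complement_lines G" for l
    using that by (auto simp: complement_lines_def)
  have "complement_lines G \<subseteq> Pow (pverts G)"
    by (auto simp: complement_lines_def)
  then have "finite (complement_lines G)"
    using pair_finite_verts by (simp add: finite_subset)
  then have pent: "pent (pverts G) (complement_lines G) 2 r w \<longleftrightarrow> pverts G \<noteq> {} \<and>
      (\<forall>x\<in>pverts G. card {l \<in> complement_lines G. x \<in> l} = r \<and> card (parcs G `` {x}) = w \<and>
        (\<forall>y z. (x, y) \<in> parcs G \<and> (x, z) \<in> parcs G \<longrightarrow> (y, z) \<notin> parcs G))"
    using assms lines partial_linear_space_complement_lines
    by (simp add: pent_def opposite_design_complement_lines_iff ball_conj_distrib)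
  have regular: "regular_graph G w \<longleftrightarrow> (\<forall>x\<in>pverts G. card (parcs G `` {x}) = w)"
    using pair_graph_axioms by (simp add: regular_graph_def out_degree_eq_card_neighbours)
  have triangles: "triangle_free (parcs G) \<longleftrightarrow> (\<forall>x\<in>pverts G.
      \<forall>y z. (x, y) \<in> parcs G \<and> (x, z) \<in> parcs G \<longrightarrow> (y, z) \<notin> parcs G)"
    by (auto simp: triangle_free_def dest: wellformed')
  have degree: "card {l \<in> complement_lines G. x \<in> l} = r \<longleftrightarrow> card (pverts G) = r + w + 1"
    if "x \<in> pverts G" "card (parcs G `` {x}) = w" for x
    using card_pverts_eq_lines_plus_neighbours that by auto
  show ?thesis
  proof
    assume P: "pent (pverts G) (complement_lines G) 2 r w"
    then obtain x where "x \<in> pverts G" by (auto simp: pent)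
    then have "card (pverts G) = r + w + 1"
      using P degree[of x] unfolding pent by blast
    with P show "regular_graph G w \<and> card (pverts G) = r + w + 1 \<and> girth G \<ge> 4"
      unfolding pent regular girth_ge_4_iff triangles by blast
  next
    assume G: "regular_graph G w \<and> card (pverts G) = r + w + 1 \<and> girth G \<ge> 4"
    then have "card {l \<in> complement_lines G. x \<in> l} = r" if "x \<in> pverts G" for x
      using degree[of x] that unfolding regular by blast
    moreover have "pverts G \<noteq> {}" using G by auto
    ultimately show "pent (pverts G) (complement_lines G) 2 r w"
      using G unfolding pent regular girth_ge_4_iff triangles by blast
  qed
qed

text \<open>The blocks of \<open>x\<^sup>o\<^sup>p\<^sup>p\<close> are the pairs of neighbours of \<open>x\<close>, so a block common to \<open>x\<^sup>o\<^sup>p\<^sup>p\<close> and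
  \<open>y\<^sup>o\<^sup>p\<^sup>p\<close> is a pair of common neighbours of \<open>x\<close> and \<open>y\<close>.\<close>

lemma disjoint_opposite_designs_complement_lines_iff:
  assumes "pent (pverts G) (complement_lines G) 2 r w"
  shows "disjoint_opposite_designs (pverts G) (complement_lines G) 2 w \<longleftrightarrow>
    common_neighbours_unique (parcs G)"
proof -
  let ?opp = "opposite_design (pverts G) (complement_lines G) 2 w"
  have opp: "?opp x B \<longleftrightarrow> B = [parcs G `` {x}]\<^bsup>2\<^esup>" if "x \<in> pverts G" for x B
  proof -
    have "\<exists>C. ?opp x C"
      using assms that by (simp add: pent_def)
    then show ?thesis
      by (auto simp only: opposite_design_complement_lines_iff[OF that])
  qed
  have common: "[A]\<^bsup>2\<^esup> \<inter> [B]\<^bsup>2\<^esup> = {} \<longleftrightarrow> (\<forall>u v. u \<in> A \<inter> B \<and> v \<in> A \<inter> B \<longrightarrow> u = v)"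
    for A B :: "'a set"
  proof -
    have "[A]\<^bsup>2\<^esup> \<inter> [B]\<^bsup>2\<^esup> = [A \<inter> B]\<^bsup>2\<^esup>" by (auto simp: nsets_def)
    also have "\<dots> = {} \<longleftrightarrow> (\<forall>u v. u \<in> A \<inter> B \<and> v \<in> A \<inter> B \<longrightarrow> u = v)"
    proof
      assume empty: "[A \<inter> B]\<^bsup>2\<^esup> = {}"
      show "\<forall>u v. u \<in> A \<inter> B \<and> v \<in> A \<inter> B \<longrightarrow> u = v"
      proof (intro allI impI, rule ccontr)
        fix u v assume "u \<in> A \<inter> B \<and> v \<in> A \<inter> B" "u \<noteq> v"
        then have "{u, v} \<in> [A \<inter> B]\<^bsup>2\<^esup>" by (simp add: nsets_def)
        with empty show False by simp
      qed
    qed (auto simp: nsets_def card_2_iff)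
    finally show ?thesis .
  qed
  have "disjoint_opposite_designs (pverts G) (complement_lines G) 2 w \<longleftrightarrow>
    (\<forall>x\<in>pverts G. \<forall>y\<in>pverts G. x \<noteq> y \<longrightarrow> [parcs G `` {x}]\<^bsup>2\<^esup> \<inter> [parcs G `` {y}]\<^bsup>2\<^esup> = {})"
    unfolding disjoint_opposite_designs_def by (simp add: opp)
  also have "\<dots> \<longleftrightarrow> common_neighbours_unique (parcs G)"
    unfolding common common_neighbours_unique_def using wellformed' by blast
  finally show ?thesis .
qed

lemma disjoint_pent_complement_lines_iff:
  assumes "w \<ge> 2"
  shows "pent (pverts G) (complement_lines G) 2 r w \<and>
      disjoint_opposite_designs (pverts G) (complement_lines G) 2 w \<longleftrightarrow>
    regular_graph G w \<and> card (pverts G) = r + w + 1 \<and> girth G \<ge> 5"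
  using pent_complement_lines_iff[OF assms, of r] disjoint_opposite_designs_complement_lines_iff[of r w]
  unfolding girth_ge_4_iff girth_ge_5_iff by blast

end

section \<open>Pentagonal geometries and graphs of given girth\<close>

theorem theorem2p1:
  fixes r w v :: nat
  assumes "r \<ge> w - 1" and "w - 1 \<ge> 1" and "even (r * w)" and "v = r + w + 1"
  shows "((\<exists>(P :: 'a::infinite set) L. pent P L 2 r w) \<longleftrightarrow>
         (\<exists>G :: 'b::infinite pair_pre_digraph.
            regular_graph G w \<and> card (pverts G) = v \<and> girth G \<ge> 4)) \<and>
         ((\<exists>(P :: 'a::infinite set) L. pent P L 2 r w \<and> disjoint_opposite_designs P L 2 w) \<longleftrightarrow>
         (\<exists>G :: 'b::infinite pair_pre_digraph.
            regular_graph G w \<and> card (pverts G) = v \<and> girth G \<ge> 5))"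
proof -
  have w: "w \<ge> 2" and v: "v = r + w + 1" using assms by simp_all
  have "(\<exists>(P :: 'a set) L. pent P L 2 r w) \<longleftrightarrow>
      (\<exists>G :: 'a pair_pre_digraph. regular_graph G w \<and> card (pverts G) = v \<and> girth G \<ge> 4)"
    (is "?pent \<longleftrightarrow> (\<exists>G. ?graph4 G)")
  proof
    assume ?pent
    then obtain P :: "'a set" and L where L: "pent P L 2 r w" by blast
    then obtain G where "pair_graph G" "pverts G = P" "complement_lines G = L"
      by (rule pent_2_obtains_graph)
    with L have "?graph4 G"
      using pair_graph.pent_complement_lines_iff[OF _ w, of G r] v by simp
    then show "\<exists>G. ?graph4 G" ..
  next
    assume "\<exists>G. ?graph4 G"
    then obtain G :: "'a pair_pre_digraph" where "?graph4 G" ..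
    then have "pent (pverts G) (complement_lines G) 2 r w"
      using pair_graph.pent_complement_lines_iff[OF _ w, of G r] v by (simp add: regular_graph_def)
    then show ?pent by blast
  qed
  moreover have "(\<exists>(P :: 'a set) L. pent P L 2 r w \<and> disjoint_opposite_designs P L 2 w) \<longleftrightarrow>
      (\<exists>G :: 'a pair_pre_digraph. regular_graph G w \<and> card (pverts G) = v \<and> girth G \<ge> 5)"
    (is "?disjoint \<longleftrightarrow> (\<exists>G. ?graph5 G)")
  proof
    assume ?disjoint
    then obtain P :: "'a set" and L
      where L: "pent P L 2 r w" "disjoint_opposite_designs P L 2 w" by blast
    from L(1) obtain G where "pair_graph G" "pverts G = P" "complement_lines G = L"
      by (rule pent_2_obtains_graph)
    with L have "?graph5 G"
      using pair_graph.disjoint_pent_complement_lines_iff[OF _ w, of G r] v by simp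
    then show "\<exists>G. ?graph5 G" ..
  next
    assume "\<exists>G. ?graph5 G"
    then obtain G :: "'a pair_pre_digraph" where "?graph5 G" ..
    then have "pent (pverts G) (complement_lines G) 2 r w \<and>
        disjoint_opposite_designs (pverts G) (complement_lines G) 2 w"
      using pair_graph.disjoint_pent_complement_lines_iff[OF _ w, of G r] v
      by (simp add: regular_graph_def)
    then show ?disjoint by blast
  qed
  \<comment> \<open>So far the vertices are the points themselves; copying moves them to the vertex type.\<close>
  moreover have "(\<exists>G :: 'a pair_pre_digraph.
        regular_graph G w \<and> card (pverts G) = v \<and> girth G \<ge> g) \<longleftrightarrow>
      (\<exists>G :: 'b pair_pre_digraph.
        regular_graph G w \<and> card (pverts G) = v \<and> girth G \<ge> g)" for g
    by (intro iffI) (erule exE, erule regular_graph_copy)+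
  ultimately show ?thesis by (simp only: simp_thms)
qed

end
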